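(* Let $\mu>0$ and $\tau>0$ be fixed. Consider the logarithmic barrier problem $$\text{(B)}\quad \min_{x,t}\ f(x)-\mu\sum_{j=1}^m\ln t_j\quad\text{s.t. } h_i(x)=0\ (i=1,\ldots,m_e),\quad c_j(x)+t_j=0\ (j=1,\ldots,m),$$ and the relaxation problem $$\text{(P)}\quad \min_{x,t,s}\ f(x)-\mu\sum_{j=1}^m\ln z_j\quad\text{s.t. } h_i(x)=0\ (i=1,\ldots,m_e),\quad c_j(x)+t_j=0,\quad z_j-t_j=0\ (j=1,\ldots,m),$$ where $z_j=z_j(t,s;\mu,\tau)$. (i) If $((x^*,t^* ),(\lambda^*,s^* ))$ is a KKT pair of (B), i.e. $(x^*,t^*,\lambda^*,s^* )$ satisfies $$\nabla f(x)+\sum_{i=1}^{m_e}\lambda_i\nabla h_i(x)+\sum_{j=1}^m s_j\nabla c_j(x)=0,\quad t_j>0,\ s_j>0,\ t_js_j-\mu=0,\quad h_i(x)=0,\quad c_j(x)+t_j=0 \qquad (\mathrm K)$$ for all $i=1,\ldots,m_e$ and $j=1,\ldots,m$, where $\lambda^*\in\mathbb R^{m_e}$ and $s^*\in\mathbb R^m$ are the Lagrange multipliers of the two groups of constraints of (B), then $((x^*,t^*,s^* ),(\lambda^*,s^*,s^* ))$ is a KKT pair of (P); that is, $\lambda^*$, $s^*$ and $s^*$ are corresponding Lagrange multipliers of the constraints $h_i(x)=0$, $c_j(x)+t_j=0$ and $z_j-t_j=0$, respectively. (ii) Conversely, if $((x^*,t^*,s^* ),(\lambda^*,\beta^*,\nu^*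 ))$ is a KKT pair of (P), where $\lambda^*\in\mathbb R^{m_e}$, $\beta^*\in\mathbb R^m$, $\nu^*\in\mathbb R^m$ are the Lagrange multipliers of the constraints $h_i(x)=0$, $c_j(x)+t_j=0$ and $z_j-t_j=0$, respectively, then $\beta^*=\nu^*=\frac1\tau\, y(t^*,s^*;\mu,\tau)=s^*$ and $(x^*,t^*,\lambda^*,s^* )$ satisfies (K). Thus $((x^*,t^* ),(\lambda^*,s^* ))$ is a KKT pair of (B).
   Context: $f,h_i,c_j:\mathbb R^n\to\mathbb R$ ($i=1,\ldots,m_e$, $j=1,\ldots,m$) are twice continuously differentiable. For $t,s\in\mathbb R^m$ (not required to be positive) the vectors $z=z(t,s;\mu,\tau)$ and $y=y(t,s;\mu,\tau)$ in $\mathbb R^m$ are defined by $$z_j=\tfrac12\Big(\sqrt{(\tau s_j-t_j)^2+4\tau\mu}-(\tau s_j-t_j)\Big),\qquad y_j=\tfrac12\Big(\sqrt{(\tau s_j-t_j)^2+4\tau\mu}+(\tau s_j-t_j)\Big).$$ (P) is an equality constrained problem in the variables $(x,t,s)\in\mathbb R^{n+2m}$. A KKT pair of (P) is a point $(x,t,s)$ together with multipliers $(\lambda,\beta,\nu)$ such that the point is feasible and the gradient with respect to $(x,t,s)$ of the Lagrangian $f(x)-\mu\sum_j\ln z_j+\sum_i\lambda_ih_i(x)+\sum_j\beta_j(c_j(x)+t_j)+\sum_j\nu_j(z_j-t_j)$ vanishes there. A KKT pair of (B) is a pair $((x,t),(\lambda,s))$ satisfying the system (K). *)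

theory Defs
  imports "HOL-Analysis.Analysis"
begin

definition gradient :: "('a::real_inner \<Rightarrow> real) \<Rightarrow> 'a \<Rightarrow> 'a" where
  "gradient f x = (THE D. GDERIV f x :> D)"

(* g is the gradient field and H the Hessian. *)
definition twice_cont_differentiable :: "(real^'n \<Rightarrow> real) \<Rightarrow> bool" where
  "twice_cont_differentiable f \<longleftrightarrow>
     (\<exists>(g :: real^'n \<Rightarrow> real^'n) (H :: real^'n \<Rightarrow> real^'n^'n).
        (\<forall>x. GDERIV f x :> g x) \<and>
        (\<forall>x. (g has_derivative (\<lambda>v. H x *v v)) (at x)) \<and>
        continuous_on UNIV H)"

definition zvec :: "real^'m \<Rightarrow> real^'m \<Rightarrow> real \<Rightarrow> real \<Rightarrow> real^'m" where
  "zvec t s \<mu> \<tau> =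
     (\<chi> j. (sqrt ((\<tau> * s $ j - t $ j)\<^sup>2 + 4 * \<tau> * \<mu>) - (\<tau> * s $ j - t $ j)) / 2)"

definition yvec :: "real^'m \<Rightarrow> real^'m \<Rightarrow> real \<Rightarrow> real \<Rightarrow> real^'m" where
  "yvec t s \<mu> \<tau> =
     (\<chi> j. (sqrt ((\<tau> * s $ j - t $ j)\<^sup>2 + 4 * \<tau> * \<mu>) + (\<tau> * s $ j - t $ j)) / 2)"

(* The m_e equality constraints h and their multipliers lam are indexed by {1..me}, so that
   me = 0 is allowed; values of h and lam outside {1..me} are irrelevant. *)

(* The system (K). *)
definition KKT_pair_B ::
  "nat \<Rightarrow> (real^'n \<Rightarrow> real) \<Rightarrow> (nat \<Rightarrow> real^'n \<Rightarrow> real) \<Rightarrow> ('m \<Rightarrow> real^'n \<Rightarrow> real) \<Rightarrow> real \<Rightarrow>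
   (real^'n) \<times> (real^'m) \<Rightarrow> (nat \<Rightarrow> real) \<times> (real^'m) \<Rightarrow> bool" where
  "KKT_pair_B me f h c \<mu> = (\<lambda>(x, t) (lam, s).
     gradient f x + (\<Sum>i=1..me. lam i *\<^sub>R gradient (h i) x)
       + (\<Sum>j\<in>UNIV. s $ j *\<^sub>R gradient (c j) x) = 0 \<and>
     (\<forall>j. t $ j > 0 \<and> s $ j > 0 \<and> t $ j * s $ j - \<mu> = 0) \<and>
     (\<forall>i\<in>{1..me}. h i x = 0) \<and>
     (\<forall>j. c j x + t $ j = 0))"

definition lagrangian_P ::
  "nat \<Rightarrow> (real^'n \<Rightarrow> real) \<Rightarrow> (nat \<Rightarrow> real^'n \<Rightarrow> real) \<Rightarrow> ('m \<Rightarrow> real^'n \<Rightarrow> real) \<Rightarrow> real \<Rightarrow> real \<Rightarrow>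
   (nat \<Rightarrow> real) \<times> (real^'m) \<times> (real^'m) \<Rightarrow> (real^'n) \<times> (real^'m) \<times> (real^'m) \<Rightarrow> real" where
  "lagrangian_P me f h c \<mu> \<tau> = (\<lambda>(lam, \<beta>, \<nu>) (x, t, s).
     f x - \<mu> * (\<Sum>j\<in>UNIV. ln (zvec t s \<mu> \<tau> $ j))
       + (\<Sum>i=1..me. lam i * h i x)
       + (\<Sum>j\<in>UNIV. \<beta> $ j * (c j x + t $ j))
       + (\<Sum>j\<in>UNIV. \<nu> $ j * (zvec t s \<mu> \<tau> $ j - t $ j)))"

definition feasible_P ::
  "nat \<Rightarrow> (nat \<Rightarrow> real^'n \<Rightarrow> real) \<Rightarrow> ('m \<Rightarrow> real^'n \<Rightarrow> real) \<Rightarrow> real \<Rightarrow> real \<Rightarrow>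
   (real^'n) \<times> (real^'m) \<times> (real^'m) \<Rightarrow> bool" where
  "feasible_P me h c \<mu> \<tau> = (\<lambda>(x, t, s).
     (\<forall>i\<in>{1..me}. h i x = 0) \<and>
     (\<forall>j. c j x + t $ j = 0) \<and>
     (\<forall>j. zvec t s \<mu> \<tau> $ j - t $ j = 0))"

(* The gradient is taken in the product space of all (x, t, s). *)
definition KKT_pair_P ::
  "nat \<Rightarrow> (real^'n \<Rightarrow> real) \<Rightarrow> (nat \<Rightarrow> real^'n \<Rightarrow> real) \<Rightarrow> ('m \<Rightarrow> real^'n \<Rightarrow> real) \<Rightarrow> real \<Rightarrow> real \<Rightarrow>
   (real^'n) \<times> (real^'m) \<times> (real^'m) \<Rightarrow> (nat \<Rightarrow> real) \<times> (real^'m) \<times> (real^'m) \<Rightarrow> bool" where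
  "KKT_pair_P me f h c \<mu> \<tau> w multipliers \<longleftrightarrow>
     feasible_P me h c \<mu> \<tau> w \<and> GDERIV (lagrangian_P me f h c \<mu> \<tau> multipliers) w :> 0"

end

theory Submission
  imports Defs
begin

text \<open>
  Write \<open>z\<close> and \<open>y\<close> for components of \<^const>\<open>zvec\<close> and \<^const>\<open>yvec\<close>. They are the two positive
  numbers with \<open>z * y = \<tau> * \<mu>\<close> and \<open>y - z = \<tau> * s - t\<close>. Hence the constraint \<open>z = t\<close> of the
  relaxation problem says \<open>y = \<tau> * s\<close> as well, and therefore already encodes \<open>t > 0\<close>, \<open>s > 0\<close> and
  \<open>t * s = \<mu>\<close>, the complementarity part of the barrier system (\<open>zvec_eq_iff_complementarity\<close>).

  It remains to compare the stationarity conditions. Only \<open>z\<close> depends on \<open>s\<close>, and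
  \<open>dz = z / (y + z) * (dt - \<tau> * ds)\<close> with a nonzero factor, so the \<open>s\<close>-part of the gradient of the
  Lagrangian vanishes exactly when the coefficient \<open>\<nu> - \<mu> / z\<close> of \<open>dz\<close> does, that is, when
  \<open>\<nu> = \<mu> / z = y / \<tau>\<close>. Given this, the \<open>t\<close>-part reduces to \<open>\<beta> - \<nu>\<close>, while the \<open>x\<close>-part is the
  stationarity equation of the barrier problem with \<open>\<beta>\<close> in the role of \<open>s\<close>
  (\<open>lagrangian_P_stationary_iff\<close>). At a feasible point \<open>y / \<tau> = s\<close>, so that \<open>\<beta> = \<nu> = s\<close>. Both
  implications follow from these two equivalences.
\<close>

section \<open>Gradients\<close>

lemma gradient_eqI:
  assumes "GDERIV f x :> D"
  shows "gradient f x = D"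
  unfolding gradient_def
proof (rule the_equality)
  show "GDERIV f x :> D" by (rule assms)
next
  fix D' assume "GDERIV f x :> D'"
  then have "(\<lambda>v. v \<bullet> D') = (\<lambda>v. v \<bullet> D)"
    using assms unfolding gderiv_def by (rule has_derivative_unique)
  then have "\<forall>v. v \<bullet> D' = v \<bullet> D" by (rule fun_cong[THEN allI])
  then show "D' = D" by (simp add: vector_eq_ldot)
qed

lemma twice_cont_differentiable_has_derivative:
  assumes "twice_cont_differentiable f"
  shows "(f has_derivative (\<lambda>v. v \<bullet> gradient f x)) (at x)"
  using assms gradient_eqI unfolding twice_cont_differentiable_def gderiv_def by metis

lemma GDERIV_0_iff:
  assumes "GDERIV f x :> D"
  shows "GDERIV f x :> 0 \<longleftrightarrow> D = 0"
  using assms gradient_eqI by metis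

section \<open>The functions z and y\<close>

lemma abs_less_sqrt_square_add:
  fixes u a :: real
  assumes "a > 0"
  shows "\<bar>u\<bar> < sqrt (u\<^sup>2 + a)"
  using assms real_less_rsqrt[of "\<bar>u\<bar>" "u\<^sup>2 + a"] by simp

lemma yvec_minus_zvec: "yvec t s \<mu> \<tau> $ j - zvec t s \<mu> \<tau> $ j = \<tau> * s $ j - t $ j"
  by (simp add: zvec_def yvec_def field_simps)

context
  fixes \<mu> \<tau> :: real
  assumes mu_pos: "\<mu> > 0" and tau_pos: "\<tau> > 0"
begin

lemma zvec_pos: "zvec t s \<mu> \<tau> $ j > 0"
  using abs_less_sqrt_square_add[of "4 * \<tau> * \<mu>" "\<tau> * s $ j - t $ j"] mu_pos tau_pos
  by (simp add: zvec_def)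

lemma yvec_pos: "yvec t s \<mu> \<tau> $ j > 0"
  using abs_less_sqrt_square_add[of "4 * \<tau> * \<mu>" "\<tau> * s $ j - t $ j"] mu_pos tau_pos
  by (simp add: yvec_def)

lemma zvec_mult_yvec: "zvec t s \<mu> \<tau> $ j * yvec t s \<mu> \<tau> $ j = \<tau> * \<mu>"
proof -
  define u where "u = \<tau> * s $ j - t $ j"
  define r where "r = sqrt (u\<^sup>2 + 4 * \<tau> * \<mu>)"
  have r2: "r\<^sup>2 = u\<^sup>2 + 4 * \<tau> * \<mu>"
    unfolding r_def using mu_pos tau_pos by simp
  have "zvec t s \<mu> \<tau> $ j * yvec t s \<mu> \<tau> $ j = (r - u) / 2 * ((r + u) / 2)"
    by (simp add: zvec_def yvec_def flip: u_def r_def)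
  also have "\<dots> = (r\<^sup>2 - u\<^sup>2) / 4"
    by (simp add: field_simps power2_eq_square)
  finally show ?thesis using r2 by simp
qed

lemma mu_divide_zvec: "\<mu> / zvec t s \<mu> \<tau> $ j = yvec t s \<mu> \<tau> $ j / \<tau>"
  using zvec_mult_yvec[of t s j] zvec_pos[of t s j] tau_pos by (simp add: field_simps)

text \<open>
  The pair \<open>z\<close>, \<open>y\<close> is determined by its positivity, product and difference: \<open>z\<close> is the only
  positive root of \<open>z * (z + \<tau> * s - t) = \<tau> * \<mu>\<close>. If \<open>t\<close> and \<open>s\<close> are positive with \<open>t * s = \<mu>\<close>,
  this equation factors as \<open>(z - t) * (z + \<tau> * s) = 0\<close>. Conversely, \<open>z = t\<close> forces
  \<open>y = \<tau> * s\<close>, and positivity and product pass from \<open>z\<close>, \<open>y\<close> to \<open>t\<close>, \<open>s\<close>.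
\<close>
lemma zvec_eq_iff_complementarity:
  "zvec t s \<mu> \<tau> $ j = t $ j \<longleftrightarrow> t $ j > 0 \<and> s $ j > 0 \<and> t $ j * s $ j = \<mu>"
proof -
  let ?z = "zvec t s \<mu> \<tau> $ j" and ?y = "yvec t s \<mu> \<tau> $ j"
  have diff: "?y - ?z = \<tau> * s $ j - t $ j" and prod: "?z * ?y = \<tau> * \<mu>"
    by (rule yvec_minus_zvec zvec_mult_yvec)+
  show ?thesis
  proof
    assume eq: "?z = t $ j"
    then have y: "?y = \<tau> * s $ j" using diff by simp
    have "\<tau> * (t $ j * s $ j) = \<tau> * \<mu>" using prod eq y by (simp add: ac_simps)
    then show "t $ j > 0 \<and> s $ j > 0 \<and> t $ j * s $ j = \<mu>"
      using eq y zvec_pos[of t s j] yvec_pos[of t s j] tau_pos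
      by (simp add: zero_less_mult_iff)
  next
    assume ts: "t $ j > 0 \<and> s $ j > 0 \<and> t $ j * s $ j = \<mu>"
    have "?z * ?y = \<tau> * (t $ j * s $ j)" using prod ts by simp
    moreover have "?y = ?z + \<tau> * s $ j - t $ j" using diff by simp
    ultimately have "?z * (?z + \<tau> * s $ j - t $ j) = \<tau> * (t $ j * s $ j)" by simp
    then have "(?z - t $ j) * (?z + \<tau> * s $ j) = 0" by (simp add: algebra_simps)
    moreover have "?z + \<tau> * s $ j > 0" using ts zvec_pos[of t s j] tau_pos by (simp add: add_pos_pos)
    ultimately show "?z = t $ j" by simp
  qed
qed

text \<open>
  The scalar function \<open>u \<mapsto> (sqrt (u\<^sup>2 + 4 * \<tau> * \<mu>) - u) / 2\<close> at \<open>u = \<tau> * s - t\<close> has value \<open>z\<close>, and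
  its derivative is \<open>- z / (y + z)\<close> because the square root there equals \<open>y + z\<close>.
\<close>
lemma zvec_has_derivative:
  "((\<lambda>w. zvec (fst (snd w)) (snd (snd w)) \<mu> \<tau> $ j) has_derivative
     (\<lambda>v. zvec t s \<mu> \<tau> $ j / (yvec t s \<mu> \<tau> $ j + zvec t s \<mu> \<tau> $ j)
            * (fst (snd v) $ j - \<tau> * snd (snd v) $ j)))
     (at (x :: 'a::real_normed_vector, t, s))"
proof -
  let ?\<phi> = "\<lambda>u. (sqrt (u\<^sup>2 + 4 * \<tau> * \<mu>) - u) / 2"
  let ?z = "zvec t s \<mu> \<tau> $ j" and ?y = "yvec t s \<mu> \<tau> $ j"
  define u where "u = \<tau> * s $ j - t $ j"
  have pos: "u\<^sup>2 + 4 * \<tau> * \<mu> > 0"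
    using mu_pos tau_pos by (simp add: add_nonneg_pos)
  have root: "sqrt (u\<^sup>2 + 4 * \<tau> * \<mu>) = ?y + ?z"
    by (simp add: zvec_def yvec_def add_divide_distrib[symmetric] flip: u_def)
  have u: "u = ?y - ?z"
    unfolding u_def by (simp only: yvec_minus_zvec)
  have nz: "?y + ?z > 0"
    using zvec_pos[of t s j] yvec_pos[of t s j] by simp
  have "(?\<phi> has_real_derivative (u / sqrt (u\<^sup>2 + 4 * \<tau> * \<mu>) - 1) / 2) (at u)"
    using pos by (auto intro!: derivative_eq_intros simp: field_simps)
  also have "(u / sqrt (u\<^sup>2 + 4 * \<tau> * \<mu>) - 1) / 2 = - (?z / (?y + ?z))"
    unfolding root unfolding u using nz by (simp add: field_simps)
  finally have outer: "(?\<phi> has_derivative (*) (- (?z / (?y + ?z)))) (at u)"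
    by (simp add: has_field_derivative_def)
  have inner: "((\<lambda>w. \<tau> * snd (snd w) $ j - fst (snd w) $ j) has_derivative
      (\<lambda>v. \<tau> * snd (snd v) $ j - fst (snd v) $ j)) (at (x, t, s))"
    by (auto intro!: derivative_eq_intros
        bounded_linear.has_derivative[OF bounded_linear_vec_nth])
  have "((\<lambda>w. ?\<phi> (\<tau> * snd (snd w) $ j - fst (snd w) $ j)) has_derivative
      (\<lambda>v. - (?z / (?y + ?z)) * (\<tau> * snd (snd v) $ j - fst (snd v) $ j))) (at (x, t, s))"
    using has_derivative_compose[OF inner, of ?\<phi> "(*) (- (?z / (?y + ?z)))"] outer
    by (simp add: u_def)
  moreover have "- (?z / (?y + ?z)) * (\<tau> * b - a) = ?z / (?y + ?z) * (a - \<tau> * b)" for a b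
    by (metis minus_diff_eq minus_mult_commute)
  moreover have "(\<lambda>w :: 'a \<times> _. zvec (fst (snd w)) (snd (snd w)) \<mu> \<tau> $ j) =
      (\<lambda>w. ?\<phi> (\<tau> * snd (snd w) $ j - fst (snd w) $ j))"
    by (simp add: zvec_def)
  ultimately show ?thesis by (simp only:)
qed

section \<open>Stationary points of the Lagrangian\<close>

context
  fixes f :: "real^'n \<Rightarrow> real"
    and h :: "nat \<Rightarrow> real^'n \<Rightarrow> real"
    and c :: "'m::finite \<Rightarrow> real^'n \<Rightarrow> real"
    and me :: nat
  assumes f_diff: "twice_cont_differentiable f"
    and h_diff: "\<forall>i\<in>{1..me}. twice_cont_differentiable (h i)"
    and c_diff: "\<And>j. twice_cont_differentiable (c j)"
begin

text \<open>
  The Lagrangian depends on \<open>z\<close> through \<open>\<nu> * z - \<mu> * ln z\<close> in each component. Its differential is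
  \<open>(\<nu> - \<mu> / z) * dz = a * (dt - \<tau> * ds)\<close>, which contributes \<open>a\<close> to the \<open>t\<close>-part and
  \<open>- \<tau> * a\<close> to the \<open>s\<close>-part.
\<close>
lemma lagrangian_P_GDERIV:
  fixes x :: "real^'n" and t s \<beta> \<nu> :: "real^'m" and lam :: "nat \<Rightarrow> real"
  defines "z \<equiv> zvec t s \<mu> \<tau>"
  defines "a \<equiv> \<lambda>j. (\<nu> $ j - \<mu> / z $ j) * (z $ j / (yvec t s \<mu> \<tau> $ j + z $ j))"
  shows "GDERIV (lagrangian_P me f h c \<mu> \<tau> (lam, \<beta>, \<nu>)) (x, t, s) :>
    (gradient f x + (\<Sum>i=1..me. lam i *\<^sub>R gradient (h i) x)
       + (\<Sum>j\<in>UNIV. \<beta> $ j *\<^sub>R gradient (c j) x),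
     \<chi> j. \<beta> $ j - \<nu> $ j + a j,
     \<chi> j. - \<tau> * a j)"
proof -
  let ?w = "(x, t, s)"
  let ?dz = "\<lambda>j v. z $ j / (yvec t s \<mu> \<tau> $ j + z $ j) * (fst (snd v) $ j - \<tau> * snd (snd v) $ j)"
  have of_x: "((\<lambda>w. g (fst w)) has_derivative (\<lambda>v. fst v \<bullet> gradient g x)) (at ?w)"
    if "twice_cont_differentiable g" for g :: "real^'n \<Rightarrow> real"
    using has_derivative_compose[OF has_derivative_fst[OF has_derivative_ident], of g _ ?w UNIV]
      twice_cont_differentiable_has_derivative[OF that, of x] by simp
  have dz: "((\<lambda>w. zvec (fst (snd w)) (snd (snd w)) \<mu> \<tau> $ j) has_derivative ?dz j) (at ?w)" for j
    unfolding z_def by (rule zvec_has_derivative)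
  have dln: "((\<lambda>w. ln (zvec (fst (snd w)) (snd (snd w)) \<mu> \<tau> $ j)) has_derivative
      (\<lambda>v. ?dz j v / z $ j)) (at ?w)" for j
    using has_derivative_ln[OF _ dz[of j]] zvec_pos[of t s j] by (simp add: z_def divide_inverse)
  have dt: "((\<lambda>w. fst (snd w) $ j) has_derivative (\<lambda>v. fst (snd v) $ j)) (at ?w)" for j
    by (auto intro!: derivative_eq_intros
        bounded_linear.has_derivative[OF bounded_linear_vec_nth])
  have "((\<lambda>w. f (fst w) - \<mu> * (\<Sum>j\<in>UNIV. ln (zvec (fst (snd w)) (snd (snd w)) \<mu> \<tau> $ j))
       + (\<Sum>i=1..me. lam i * h i (fst w))
       + (\<Sum>j\<in>UNIV. \<beta> $ j * (c j (fst w) + fst (snd w) $ j))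
       + (\<Sum>j\<in>UNIV. \<nu> $ j * (zvec (fst (snd w)) (snd (snd w)) \<mu> \<tau> $ j - fst (snd w) $ j)))
     has_derivative
     (\<lambda>v. fst v \<bullet> gradient f x - \<mu> * (\<Sum>j\<in>UNIV. ?dz j v / z $ j)
       + (\<Sum>i=1..me. lam i * (fst v \<bullet> gradient (h i) x))
       + (\<Sum>j\<in>UNIV. \<beta> $ j * (fst v \<bullet> gradient (c j) x + fst (snd v) $ j))
       + (\<Sum>j\<in>UNIV. \<nu> $ j * (?dz j v - fst (snd v) $ j)))) (at ?w)"
    by (intro has_derivative_add has_derivative_diff has_derivative_sum
        has_derivative_mult_right of_x dz dln dt f_diff h_diff[rule_format] c_diff)
  also have "(\<lambda>v. fst v \<bullet> gradient f x - \<mu> * (\<Sum>j\<in>UNIV. ?dz j v / z $ j)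
       + (\<Sum>i=1..me. lam i * (fst v \<bullet> gradient (h i) x))
       + (\<Sum>j\<in>UNIV. \<beta> $ j * (fst v \<bullet> gradient (c j) x + fst (snd v) $ j))
       + (\<Sum>j\<in>UNIV. \<nu> $ j * (?dz j v - fst (snd v) $ j))) =
    (\<lambda>v. v \<bullet> (gradient f x + (\<Sum>i=1..me. lam i *\<^sub>R gradient (h i) x)
       + (\<Sum>j\<in>UNIV. \<beta> $ j *\<^sub>R gradient (c j) x),
       \<chi> j. \<beta> $ j - \<nu> $ j + a j, \<chi> j. - \<tau> * a j))"
    (is "?L = ?R")
  proof
    fix v :: "(real^'n) \<times> (real^'m) \<times> (real^'m)"
    have "\<nu> $ j * (?dz j v - fst (snd v) $ j) - \<mu> * (?dz j v / z $ j) + \<beta> $ j * fst (snd v) $ j =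
       fst (snd v) $ j * (\<beta> $ j - \<nu> $ j + a j) + snd (snd v) $ j * (- \<tau> * a j)" for j
      unfolding a_def divide_inverse by algebra
    then have "(\<Sum>j\<in>UNIV. \<nu> $ j * (?dz j v - fst (snd v) $ j) - \<mu> * (?dz j v / z $ j)
          + \<beta> $ j * fst (snd v) $ j) =
       (\<Sum>j\<in>UNIV. fst (snd v) $ j * (\<beta> $ j - \<nu> $ j + a j) + snd (snd v) $ j * (- \<tau> * a j))"
      by (intro sum.cong refl)
    then have "(\<Sum>j\<in>UNIV. \<nu> $ j * (?dz j v - fst (snd v) $ j)) - \<mu> * (\<Sum>j\<in>UNIV. ?dz j v / z $ j)
          + (\<Sum>j\<in>UNIV. \<beta> $ j * fst (snd v) $ j) =
       (\<Sum>j\<in>UNIV. fst (snd v) $ j * (\<beta> $ j - \<nu> $ j + a j))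
          + (\<Sum>j\<in>UNIV. snd (snd v) $ j * (- \<tau> * a j))"
      by (simp only: sum.distrib sum_subtractf sum_distrib_left)
    moreover have "(\<Sum>j\<in>UNIV. \<beta> $ j * (fst v \<bullet> gradient (c j) x + fst (snd v) $ j)) =
        (\<Sum>j\<in>UNIV. \<beta> $ j * (fst v \<bullet> gradient (c j) x)) + (\<Sum>j\<in>UNIV. \<beta> $ j * fst (snd v) $ j)"
      by (simp only: distrib_left sum.distrib)
    moreover have "?R v = fst v \<bullet> gradient f x + (\<Sum>i=1..me. lam i * (fst v \<bullet> gradient (h i) x))
        + (\<Sum>j\<in>UNIV. \<beta> $ j * (fst v \<bullet> gradient (c j) x))
        + ((\<Sum>j\<in>UNIV. fst (snd v) $ j * (\<beta> $ j - \<nu> $ j + a j))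
        + (\<Sum>j\<in>UNIV. snd (snd v) $ j * (- \<tau> * a j)))"
      by (simp only: inner_prod_def fst_conv snd_conv inner_add_right inner_sum_right
          inner_scaleR_right inner_vec_def[of "fst (snd v)"] inner_vec_def[of "snd (snd v)"]
          vec_lambda_beta inner_real_def)
    ultimately show "?L v = ?R v" by linarith
  qed
  finally show ?thesis
    unfolding gderiv_def lagrangian_P_def by (simp add: case_prod_unfold)
qed

text \<open>
  Stationarity alone fixes the multipliers of the last two groups
  of constraints. The \<open>s\<close>-part of the gradient gives \<open>\<nu>\<close>, and then the \<open>t\<close>-part gives \<open>\<beta>\<close>.
\<close>
lemma lagrangian_P_stationary_iff:
  fixes x :: "real^'n" and t s \<beta> \<nu> :: "real^'m"
  shows "GDERIV (lagrangian_P me f h c \<mu> \<tau> (lam, \<beta>, \<nu>)) (x, t, s) :> 0 \<longleftrightarrow>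
    gradient f x + (\<Sum>i=1..me. lam i *\<^sub>R gradient (h i) x)
       + (\<Sum>j\<in>UNIV. \<beta> $ j *\<^sub>R gradient (c j) x) = 0 \<and>
    \<beta> = \<nu> \<and> \<nu> = (1 / \<tau>) *\<^sub>R yvec t s \<mu> \<tau>"
proof -
  let ?z = "zvec t s \<mu> \<tau>" and ?y = "yvec t s \<mu> \<tau>"
  let ?a = "\<lambda>j. (\<nu> $ j - \<mu> / ?z $ j) * (?z $ j / (?y $ j + ?z $ j))"
  have a: "?a j = 0 \<longleftrightarrow> \<nu> $ j = ?y $ j / \<tau>" for j
    using zvec_pos[of t s j] yvec_pos[of t s j] mu_divide_zvec[of t s j] by auto
  have "(\<forall>j. \<beta> $ j - \<nu> $ j + ?a j = 0) \<and> (\<forall>j. - \<tau> * ?a j = 0) \<longleftrightarrow>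
      (\<forall>j. \<beta> $ j - \<nu> $ j + ?a j = 0) \<and> (\<forall>j. ?a j = 0)"
    using tau_pos by simp
  also have "\<dots> \<longleftrightarrow> (\<forall>j. \<beta> $ j = \<nu> $ j) \<and> (\<forall>j. ?a j = 0)"
    by (metis add.right_neutral right_minus_eq)
  also have "\<dots> \<longleftrightarrow> \<beta> = \<nu> \<and> \<nu> = (1 / \<tau>) *\<^sub>R ?y"
    unfolding a by (simp add: vec_eq_iff)
  finally show ?thesis
    unfolding GDERIV_0_iff[OF lagrangian_P_GDERIV] by (simp add: vec_eq_iff zero_prod_def)
qed

end

end

section \<open>Equivalence of the two KKT systems\<close>

theorem theorem2p3:
  fixes f :: "real^'n \<Rightarrow> real"
    and h :: "nat \<Rightarrow> real^'n \<Rightarrow> real"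
    and c :: "'m::finite \<Rightarrow> real^'n \<Rightarrow> real"
    and me :: nat and \<mu> \<tau> :: real
  assumes "\<mu> > 0" and "\<tau> > 0"
    and "twice_cont_differentiable f"
    and "\<And>i. i \<in> {1..me} \<Longrightarrow> twice_cont_differentiable (h i)"
    and "\<And>j. twice_cont_differentiable (c j)"
  shows "(\<forall>x t lam s.
            KKT_pair_B me f h c \<mu> (x, t) (lam, s) \<longrightarrow>
            KKT_pair_P me f h c \<mu> \<tau> (x, t, s) (lam, s, s)) \<and>
         (\<forall>x t s lam \<beta> \<nu>.
            KKT_pair_P me f h c \<mu> \<tau> (x, t, s) (lam, \<beta>, \<nu>) \<longrightarrow>
            \<beta> = \<nu> \<and> \<nu> = (1 / \<tau>) *\<^sub>R yvec t s \<mu> \<tau> \<and> (1 / \<tau>) *\<^sub>R yvec t s \<mu> \<tau> = s \<and>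
            KKT_pair_B me f h c \<mu> (x, t) (lam, s))"
proof -
  have h_diff: "\<forall>i\<in>{1..me}. twice_cont_differentiable (h i)"
    using assms(4) by blast
  note stationary = lagrangian_P_stationary_iff[OF assms(1-3) h_diff assms(5)]
  note complementarity = zvec_eq_iff_complementarity[OF assms(1,2)]
  have y_eq: "(1 / \<tau>) *\<^sub>R yvec t s \<mu> \<tau> = s" if "\<forall>j. zvec t s \<mu> \<tau> $ j = t $ j"
    for t s :: "real^'m"
  proof -
    have "yvec t s \<mu> \<tau> $ j = \<tau> * s $ j" for j
      using yvec_minus_zvec[of t s \<mu> \<tau> j] that by simp
    then show ?thesis using assms(2) by (simp add: vec_eq_iff)
  qed
  show ?thesis
  proof (intro conjI allI impI)
    fix x :: "real^'n" and t s :: "real^'m" and lam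
    assume B: "KKT_pair_B me f h c \<mu> (x, t) (lam, s)"
    then have z: "\<forall>j. zvec t s \<mu> \<tau> $ j = t $ j"
      unfolding complementarity by (simp add: KKT_pair_B_def)
    with B show "KKT_pair_P me f h c \<mu> \<tau> (x, t, s) (lam, s, s)"
      unfolding KKT_pair_P_def unfolding stationary y_eq[OF z]
      by (simp add: KKT_pair_B_def feasible_P_def)
  next
    fix x :: "real^'n" and t s \<beta> \<nu> :: "real^'m" and lam
    assume "KKT_pair_P me f h c \<mu> \<tau> (x, t, s) (lam, \<beta>, \<nu>)"
    then have feas: "feasible_P me h c \<mu> \<tau> (x, t, s)"
      and stat: "gradient f x + (\<Sum>i=1..me. lam i *\<^sub>R gradient (h i) x)
         + (\<Sum>j\<in>UNIV. \<beta> $ j *\<^sub>R gradient (c j) x) = 0"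
      and mult: "\<beta> = \<nu>" "\<nu> = (1 / \<tau>) *\<^sub>R yvec t s \<mu> \<tau>"
      unfolding KKT_pair_P_def unfolding stationary by blast+
    from feas have z: "\<forall>j. zvec t s \<mu> \<tau> $ j = t $ j"
      by (simp add: feasible_P_def)
    show "\<beta> = \<nu>" "\<nu> = (1 / \<tau>) *\<^sub>R yvec t s \<mu> \<tau>" "(1 / \<tau>) *\<^sub>R yvec t s \<mu> \<tau> = s"
      using mult y_eq[OF z] by simp_all
    then have "\<beta> = s" by simp
    with feas stat z show "KKT_pair_B me f h c \<mu> (x, t) (lam, s)"
      unfolding complementarity by (simp add: feasible_P_def KKT_pair_B_def)
  qed
qed

end
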